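(* Let $F$ be a non-archimedean local field of characteristic different from $2$, let $E/F$ be a quadratic extension, let $A$ be a central simple $F$-algebra with $\dim_F(A)$ even, and fix an embedding of $E$ in $A$ as an $F$-subalgebra. Set $G=A^\times$ and let $H$ be the centralizer of $E^\times$ in $G$. Then the involution $i:g\mapsto g^{-1}$ stabilizes each double coset $HgH\subset G$; that is, $i(HgH)=HgH$ for every $g\in G$ (equivalently, $g^{-1}\in HgH$ for every $g\in G$).
   Context: A central simple $F$-algebra $A$ is of the form $\mathcal{M}_n(D)$ with $D$ a central division $F$-algebra of dimension $d^2$ over $F$; evenness of $\dim_F(A)$ means that $nd$ is even. Then $E$ embeds in $A$ as an $F$-subalgebra, and all such embeddings are $A^\times$-conjugate. A pair $(G,H)$ as in the claim is called of Prasad--Takloo-Bighash (PTB) type. *)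

theory Defs
  imports "HOL-Analysis.Analysis"
begin

section \<open>Non-archimedean local fields\<close>

locale nonarch_absolute_value =
  fixes v :: "'f::field \<Rightarrow> real"
  assumes nonneg: "0 \<le> v x"
    and eq_0_iff: "v x = 0 \<longleftrightarrow> x = 0"
    and mult: "v (x * y) = v x * v y"
    and ultrametric: "v (x + y) \<le> max (v x) (v y)"
begin

lemma v_one: "v 1 = 1"
  using mult[of 1 1] eq_0_iff[of 1] by simp

lemma v_uminus: "v (- x) = v x"
proof -
  have "v (- 1) * v (- 1) = 1"
    using mult[of "- 1" "- 1"] v_one by simp
  then have "v (- 1) = 1"
    using nonneg[of "- 1"] by (metis abs_of_nonneg power2_eq_square power2_eq_1_iff abs_1 abs_minus_cancel)
  then show ?thesis
    using mult[of "- 1" x] by simp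
qed

lemma metric_space_v: "Metric_space UNIV (\<lambda>x y. v (x - y))"
proof
  show "0 \<le> v (x - y)" for x y by (rule nonneg)
  show "v (x - y) = v (y - x)" for x y using v_uminus[of "x - y"] by simp
  show "v (x - y) = 0 \<longleftrightarrow> x = y" for x y by (simp add: eq_0_iff)
  show "v (x - z) \<le> v (x - y) + v (y - z)" for x y z
    using ultrametric[of "x - y" "y - z"] nonneg[of "x - y"] nonneg[of "y - z"] by simp
qed

end

text \<open>
  A non-archimedean local field is a field with a nontrivial non-archimedean absolute value
  whose metric topology is locally compact. (Completeness, discreteness of the value group and
  finiteness of the residue field follow.)
\<close>

locale nonarch_local_field = nonarch_absolute_value v for v :: "'f::field \<Rightarrow> real" +
  assumes nontrivial: "\<exists>x. x \<noteq> 0 \<and> v x \<noteq> 1"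
    and locally_compact:
      "locally_compact_space (Metric_space.mtopology UNIV (\<lambda>x y. v (x - y)))"


section \<open>Algebras over a field\<close>

text \<open>
  Unital associative algebras over an arbitrary field, with the axioms of the class
  \<^class>\<open>real_algebra_1\<close> for a scalar multiplication that is passed explicitly.
\<close>

locale field_algebra = vector_space scale
  for scale :: "'f::field \<Rightarrow> 'a::ring_1 \<Rightarrow> 'a" +
  assumes mult_scale_left: "scale c x * y = scale c (x * y)"
    and mult_scale_right: "x * scale c y = scale c (x * y)"

definition center :: "'a::ring_1 set" where
  "center = {z. \<forall>x. z * x = x * z}"

definition two_sided_ideal :: "'a::ring_1 set \<Rightarrow> bool" where
  "two_sided_ideal I \<longleftrightarrow>
     0 \<in> I \<and> (\<forall>x\<in>I. \<forall>y\<in>I. x + y \<in> I) \<and> (\<forall>x\<in>I. \<forall>a. a * x \<in> I \<and> x * a \<in> I)"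

text \<open>
  Finite-dimensionality is required explicitly, since \<^const>\<open>vector_space.dim\<close> is \<open>0\<close> on an
  infinite-dimensional space. The ring is nonzero because \<^class>\<open>ring_1\<close> contains \<open>0 \<noteq> 1\<close>.
\<close>

locale central_simple_algebra = field_algebra scale
  for scale :: "'f::field \<Rightarrow> 'a::ring_1 \<Rightarrow> 'a" +
  assumes finite_dimensional: "\<exists>Basis. finite_dimensional_vector_space scale Basis"
    and central: "center = range (\<lambda>c. scale c 1)"
    and simple: "two_sided_ideal (I :: 'a set) \<Longrightarrow> I = {0} \<or> I = UNIV"

locale quadratic_extension = field_algebra scale
  for scale :: "'f::field \<Rightarrow> 'e::field \<Rightarrow> 'e" +
  assumes degree: "vector_space.dim scale UNIV = 2"

locale algebra_embedding =
  source: field_algebra scale1 + target: field_algebra scale2 + Vector_Spaces.linear scale1 scale2 \<iota>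
  for scale1 :: "'f::field \<Rightarrow> 'e::ring_1 \<Rightarrow> 'e"
    and scale2 :: "'f \<Rightarrow> 'a::ring_1 \<Rightarrow> 'a"
    and \<iota> :: "'e \<Rightarrow> 'a" +
  assumes map_one: "\<iota> 1 = 1"
    and map_mult: "\<iota> (x * y) = \<iota> x * \<iota> y"
    and injective: "inj \<iota>"


section \<open>The unit group, centralizers and double cosets\<close>

definition unit_group :: "'a::ring_1 set" where
  "unit_group = {g. \<exists>h. g * h = 1 \<and> h * g = 1}"

definition unit_inv :: "'a::ring_1 \<Rightarrow> 'a" where
  "unit_inv g = (THE h. g * h = 1 \<and> h * g = 1)"

lemma unit_inv:
  assumes "g \<in> unit_group"
  shows "g * unit_inv g = 1" and "unit_inv g * g = 1"
proof -
  have "\<exists>!h. g * h = 1 \<and> h * g = 1"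
    using assms unfolding unit_group_def
    by (smt (verit, ccfv_threshold) mem_Collect_eq mult.assoc mult_1_left mult_1_right)
  then have "g * unit_inv g = 1 \<and> unit_inv g * g = 1"
    unfolding unit_inv_def by (rule theI')
  then show "g * unit_inv g = 1" and "unit_inv g * g = 1" by auto
qed

definition centralizer :: "'a::ring_1 set \<Rightarrow> 'a set \<Rightarrow> 'a set" where
  "centralizer G X = {g \<in> G. \<forall>x\<in>X. g * x = x * g}"

definition double_coset :: "'a::ring_1 set \<Rightarrow> 'a \<Rightarrow> 'a set" where
  "double_coset H g = {h * g * k | h k. h \<in> H \<and> k \<in> H}"

end

theory Submission
  imports Defs
begin

text \<open>
  Write \<open>E = F(d)\<close> with \<open>d\<^sup>2 = t\<close> in \<open>F\<close>, let \<open>x\<close> be the image of \<open>d\<close> in \<open>A\<close> and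
  \<open>y = g x g\<^sup>-\<^sup>1\<close>. If a unit \<open>h\<close> swaps \<open>x\<close> and \<open>y\<close> by conjugation, then \<open>k = g\<^sup>-\<^sup>1 h\<close> and
  \<open>l = h g\<close> centralize \<open>x\<close>, and \<open>g\<^sup>-\<^sup>1 = k g l\<^sup>-\<^sup>1\<close>. By Fitting's lemma applied to \<open>h\<^sup>2\<close>, which
  commutes with \<open>x\<close> and \<open>y\<close>, such a unit can be assembled corner by corner from swapping elements
  that are merely not nilpotent. In a corner where \<open>x + y\<close> is not nilpotent, it is one. Otherwise
  \<open>x - y\<close> is invertible and \<open>c = (x + y) (x - y)\<^sup>-\<^sup>1\<close> is nilpotent and anticommutes with \<open>x\<close>; one
  takes \<open>(x - y) u\<close>, where \<open>u\<close> anticommutes with \<open>x\<close>, commutes with \<open>c\<close> and is not nilpotent. If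
  \<open>c\<^sup>n \<noteq> 0 = c\<^sup>n\<^sup>+\<^sup>1\<close>, the sum of the \<open>c\<^sup>i v c\<^sup>n\<^sup>-\<^sup>i\<close> commutes with \<open>c\<close> and is not nilpotent as soon
  as \<open>v c\<^sup>n\<close> is not, and its part anticommuting with \<open>x\<close> can serve as \<open>u\<close> if \<open>v c\<^sup>n\<close> anticommutes
  with \<open>x\<close>. Such a \<open>v\<close> is found in a minimal \<open>x\<close>-stable left ideal contained in \<open>A c\<^sup>n\<close>; here it matters
  that \<open>A\<close> is central simple and that \<open>t\<close> is not a square.
\<close>

section \<open>Nilpotent elements of rings\<close>

text \<open>Anticommutation gives \<open>(a * b) ^ 2 = - (a ^ 2 * b ^ 2)\<close>, and the squares
  commute, so powers of \<open>a\<close> collect on the left.\<close>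

lemma anticommuting_nilpotent:
  fixes a b :: "'a::ring_1"
  assumes ab: "a * b = - (b * a)" and a: "a ^ m = 0"
  shows "(a * b) ^ (2 * m) = 0"
proof -
  have sq: "(a * b) * (a * b) = - ((a * a) * (b * b))"
    using ab by (metis minus_minus mult.assoc mult_minus_left mult_minus_right)
  have comm: "(b * b) * (a * a) = (a * a) * (b * b)"
    using ab by (metis minus_minus mult.assoc mult_minus_left mult_minus_right)
  have "\<exists>z. ((a * b) * (a * b)) ^ j = (a * a) ^ j * z" for j
  proof (induction j)
    case (Suc j)
    then obtain z where z: "((a * b) * (a * b)) ^ j = (a * a) ^ j * z" by blast
    have "((a * b) * (a * b)) ^ Suc j = (a * b) * (a * b) * ((a * a) ^ j * z)"
      by (simp only: power_Suc z)
    also have "\<dots> = - ((a * a) * ((b * b) * (a * a) ^ j) * z)"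
      unfolding sq by (simp add: mult.assoc)
    also have "(b * b) * (a * a) ^ j = (a * a) ^ j * (b * b)"
      using comm by (metis power_commuting_commutes)
    finally have "((a * b) * (a * b)) ^ Suc j = (a * a) ^ Suc j * (- (b * b * z))"
      by (simp add: mult.assoc)
    then show ?case by blast
  qed auto
  moreover have "(a * a) ^ m = 0"
    using a by (simp add: power_mult_distrib power2_eq_square[symmetric] power_mult[symmetric] mult.commute[of 2])
      (simp add: mult_2_right power_add)
  ultimately show ?thesis
    by (metis mult_zero_left power2_eq_square power_mult)
qed

text \<open>The inverse is the geometric series, which breaks off at
  \<open>p ^ m = 0\<close>.\<close>

lemma one_minus_nilpotent_invertible:
  fixes p :: "'a::ring_1"
  assumes "p ^ m = 0"
  obtains r where "(1 - p) * r = 1" "r * (1 - p) = 1"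
proof
  have "(1 - p) * (\<Sum>i<n. p ^ i) = 1 - p ^ n \<and> (\<Sum>i<n. p ^ i) * (1 - p) = 1 - p ^ n" for n
  proof (induction n)
    case (Suc n)
    then show ?case
      unfolding sum.lessThan_Suc distrib_left distrib_right
      by (simp add: left_diff_distrib right_diff_distrib power_commutes)
  qed simp
  then show "(1 - p) * (\<Sum>i<m. p ^ i) = 1" "(\<Sum>i<m. p ^ i) * (1 - p) = 1"
    using assms by auto
qed

section \<open>Subspaces, primeness and Fitting's lemma\<close>

context field_algebra
begin

lemma subspace_fixed_left: "subspace {a. e * a = a}"
  by (auto simp: subspace_def distrib_left mult_scale_right)

lemma scale_power: "scale c a ^ n = scale (c ^ n) (a ^ n)"
  by (induction n) (simp_all add: mult_scale_left mult_scale_right)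

lemma subspace_mult_right_image: "subspace S \<Longrightarrow> subspace ((\<lambda>z. z * a) ` S)"
  unfolding subspace_def
  by (auto simp: image_iff) (metis mult_zero_left, metis distrib_right, metis mult_scale_left)

end

context central_simple_algebra
begin

lemma dim_psubset_subspace:
  assumes "subspace S" "subspace T" "S \<subset> T"
  shows "dim S < dim T"
proof -
  obtain B where "finite_dimensional_vector_space scale B"
    using finite_dimensional by blast
  then interpret fd: finite_dimensional_vector_space scale B .
  show ?thesis
    using fd.dim_psubset[of S T] assms by (simp add: span_eq_iff[THEN iffD2])
qed

text \<open>The right annihilator of the right ideal \<open>l A\<close> is a two-sided ideal. It
  omits \<open>1\<close> because \<open>l \<noteq> 0\<close>, so simplicity makes it zero.\<close>

lemma prime:
  fixes l s :: 'a
  assumes "\<And>y. l * y * s = 0" and "l \<noteq> 0"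
  shows "s = 0"
proof -
  have "two_sided_ideal {s. \<forall>y. l * y * s = 0}"
    unfolding two_sided_ideal_def
    by (auto simp: distrib_left) (metis mult.assoc, metis mult.assoc mult_zero_left)
  from simple[OF this] have "{s. \<forall>y. l * y * s = 0} = {0} \<or> (1::'a) \<in> {s. \<forall>y. l * y * s = 0}"
    by blast
  then show ?thesis
    using assms by (auto dest: spec[of _ 1])
qed

text \<open>Fitting's lemma, with the inverse of \<open>a\<close> on its stable part taken in the double commutant.\<close>

lemma fitting:
  fixes a :: 'a
  obtains b n where "\<And>y. y * a = a * y \<Longrightarrow> y * b = b * y" and "a ^ n = a ^ Suc n * b"
proof -
  define T where "T = {b. \<forall>y. y * a = a * y \<longrightarrow> y * b = b * y}"
  have T: "subspace T"
    by (auto simp: T_def subspace_def distrib_left distrib_right mult_scale_left mult_scale_right)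
  have aT: "a ^ n * b \<in> T" if "b \<in> T" for n b
  proof -
    have "y * (a ^ n * b) = (a ^ n * b) * y" if y: "y * a = a * y" for y
    proof -
      have "y * a ^ n = a ^ n * y"
        using y by (metis power_commuting_commutes)
      moreover have "y * b = b * y"
        using that \<open>b \<in> T\<close> y by (auto simp: T_def)
      ultimately show ?thesis
        by (metis mult.assoc)
    qed
    then show ?thesis by (auto simp: T_def)
  qed
  have comm: "b * a = a * b" if "b \<in> T" for b
    using that by (auto simp: T_def)
  define S where "S n = (\<lambda>z. z * a ^ n) ` T" for n
  have S: "subspace (S n)" for n
    unfolding S_def by (rule subspace_mult_right_image[OF T])
  have S_sub: "S (Suc n) \<subseteq> S n" for n
  proof
    fix z assume "z \<in> S (Suc n)"
    then obtain b where b: "b \<in> T" "z = b * a ^ Suc n" by (auto simp: S_def)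
    then have "z = (a * b) * a ^ n"
      using comm by (simp add: mult.assoc[symmetric])
    moreover have "a * b \<in> T" using aT[OF b(1), of 1] by simp
    ultimately show "z \<in> S n" by (auto simp: S_def)
  qed
  \<comment> \<open>The descending chain of the \<open>T a ^ n\<close> is stationary where the
    dimension is least; there \<open>a ^ n\<close>, coming from \<open>1\<close> in
    \<open>T\<close>, lies in the next term.\<close>
  obtain n where n: "\<And>m. dim (S n) \<le> dim (S m)"
    using ex_has_least_nat[of "\<lambda>_. True" 0 "\<lambda>n. dim (S n)"] by auto
  have "S (Suc n) = S n"
    using dim_psubset_subspace[OF S S, of "Suc n" n] S_sub n[of "Suc n"] by fastforce
  moreover have "a ^ n \<in> S n"
    by (auto simp: S_def T_def intro: image_eqI[of _ _ 1])
  ultimately obtain b where b: "b \<in> T" "a ^ n = b * a ^ Suc n"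
    by (auto simp: S_def)
  have "b * a ^ Suc n = a ^ Suc n * b"
    using comm[OF b(1)] by (metis power_commuting_commutes)
  with b show thesis
    using that[of b n] by (auto simp: T_def)
qed

end

section \<open>Elements anticommuting with a square root of a non-square\<close>

text \<open>Here \<open>x\<close> stands for the image of a square root generating \<open>E\<close>.
  Elements anticommuting with \<open>x\<close> are called odd below.\<close>

locale root_in_algebra = central_simple_algebra scale
  for scale :: "'f::field \<Rightarrow> 'a::ring_1 \<Rightarrow> 'a" +
  fixes t :: 'f and x :: 'a
  assumes two: "(2::'f) \<noteq> 0"
    and nonsquare: "\<And>c. c * c \<noteq> t"
    and sq: "x * x = scale t 1"
begin

lemma t_nz: "t \<noteq> 0"
  using nonsquare[of 0] by auto

lemma sq_left: "x * (x * z) = scale t z"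
  by (simp add: mult.assoc[symmetric] sq mult_scale_left)

lemma exists_odd_element:
  assumes left: "\<And>a l. l \<in> L \<Longrightarrow> a * l \<in> L" and right: "\<And>l. l \<in> L \<Longrightarrow> l * x \<in> L"
    and sub: "\<And>l m. l \<in> L \<Longrightarrow> m \<in> L \<Longrightarrow> l - m \<in> L"
    and l0: "l0 \<in> L" "l0 \<noteq> 0"
  obtains a l where "a \<in> L" "a * x = - (x * a)" "l \<in> L" "l * a \<noteq> 0"
proof (rule ccontr)
  assume "\<not> thesis"
  then have zero: "\<And>a l. a \<in> L \<Longrightarrow> a * x = - (x * a) \<Longrightarrow> l \<in> L \<Longrightarrow> l * a = 0"
    using that by blast
  \<comment> \<open>As \<open>x * x\<close> is a scalar, the commutator of \<open>x\<close> with
    \<open>w = y * b\<close> is odd. It lies in \<open>L\<close>, so \<open>zero\<close> applies to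
    it.\<close>
  have comm: "l * y * (b * x) = l * x * y * b" if "l \<in> L" "b \<in> L" for l y b
  proof -
    have "l * (x * (y * b) - y * b * x) = 0"
    proof (rule zero)
      show "x * (y * b) - y * b * x \<in> L" using left right sub that by metis
    qed (auto simp: algebra_simps sq sq_left mult_scale_left mult_scale_right that)
    then show ?thesis by (simp add: algebra_simps)
  qed
  text \<open>Right multiplication by \<open>x\<close> on \<open>L\<close> coincides with multiplication by a central element
    \<open>X\<close>, so \<open>x\<close> would have an eigenvalue in the base field.\<close>
  define J where "J = {r. \<exists>X. \<forall>l\<in>L. \<forall>y. l * y * X = l * x * y * r}"
  have "two_sided_ideal J"
    unfolding two_sided_ideal_def
  proof (intro conjI ballI allI)
    show "0 \<in> J" by (auto simp: J_def intro: exI[of _ 0])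
  next
    fix r s assume "r \<in> J" "s \<in> J"
    then obtain X Y where "\<forall>l\<in>L. \<forall>y. l * y * X = l * x * y * r"
      "\<forall>l\<in>L. \<forall>y. l * y * Y = l * x * y * s" by (auto simp: J_def)
    then show "r + s \<in> J"
      by (auto simp: J_def distrib_left intro!: exI[of _ "X + Y"])
  next
    fix r a assume "r \<in> J"
    then obtain X where X: "\<And>l y. l\<in>L \<Longrightarrow> l * y * X = l * x * y * r" by (auto simp: J_def)
    have "l * y * (a * X) = l * x * y * (a * r)" if "l \<in> L" for l y
      using X[OF that, of "y * a"] by (simp add: mult.assoc)
    then show "a * r \<in> J" by (auto simp: J_def)
    have "l * y * (X * a) = l * x * y * (r * a)" if "l \<in> L" for l y
      using X[OF that, of y] by (metis mult.assoc)
    then show "r * a \<in> J" by (auto simp: J_def)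
  qed
  \<comment> \<open>By \<open>comm\<close>, \<open>X = l0 * x\<close> is a witness.\<close>
  moreover have "l0 \<in> J"
    using comm[OF _ l0(1)] by (auto simp: J_def)
  ultimately have "1 \<in> J"
    using simple l0(2) by blast
  then obtain X where X: "\<And>l y. l\<in>L \<Longrightarrow> l * y * X = l * x * y" by (auto simp: J_def)
  \<comment> \<open>Both \<open>l0 * y * X * r\<close> and \<open>l0 * y * r * X\<close> equal
    \<open>l0 * x * y * r\<close>, so primeness makes \<open>X\<close> central.\<close>
  have "X * r - r * X = 0" for r
  proof (rule prime[OF _ l0(2)])
    fix y
    show "l0 * y * (X * r - r * X) = 0"
      using X[OF l0(1), of y] X[OF l0(1), of "y * r"] 
      by (simp add: right_diff_distrib mult.assoc[symmetric])
  qed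
  then have "X \<in> center" by (auto simp: center_def)
  then obtain c where c: "X = scale c 1" using central by auto
  have lx: "l0 * x = scale c l0"
    using X[OF l0(1), of 1] c by (simp add: mult_scale_right)
  then have "scale t l0 = scale (c * c) l0"
    by (metis mult.assoc mult_scale_left scale_scale sq mult_scale_right mult_1_right)
  then show False
    using nonsquare l0(2) scale_right_imp_eq by metis
qed

text \<open>The condition on \<open>W\<close> makes the left ideal \<open>A W\<close> stable under
  right multiplication by \<open>x\<close>. Let \<open>L\<close> be a nonzero stable left ideal in
  it of least dimension, and \<open>a\<close> an odd element of \<open>L\<close> with
  \<open>L a \<noteq> 0\<close>. Then \<open>L a\<close> is again stable, so \<open>L a = L\<close>;
  hence \<open>L a ^ m = L\<close> for all \<open>m\<close> and \<open>a\<close> is not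
  nilpotent.\<close>

lemma exists_odd_nonnilpotent_multiple:
  assumes "W \<noteq> 0" and W: "W * x = x * W \<or> W * x = - (x * W)"
  obtains v where "v * W * x = - (x * (v * W))" "\<And>m. (v * W) ^ m \<noteq> 0"
proof -
  define good where "good L \<longleftrightarrow> subspace L \<and> (\<forall>a. \<forall>l\<in>L. a * l \<in> L) \<and> (\<forall>l\<in>L. l * x \<in> L) \<and>
    L \<noteq> {0} \<and> L \<subseteq> range (\<lambda>v. v * W)" for L
  have "good (range (\<lambda>v. v * W))"
    unfolding good_def
  proof (intro conjI ballI allI)
    show "subspace (range (\<lambda>v. v * W))" by (rule subspace_mult_right_image) simp
    show "a * l \<in> range (\<lambda>v. v * W)" if "l \<in> range (\<lambda>v. v * W)" for a l
      using that by (auto simp: mult.assoc[symmetric])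
    show "l * x \<in> range (\<lambda>v. v * W)" if l: "l \<in> range (\<lambda>v. v * W)" for l
    proof -
      obtain v where v: "l = v * W" using l by auto
      from W have "l * x = (v * x) * W \<or> l * x = (- (v * x)) * W"
        by (auto simp: v mult.assoc)
      then show ?thesis by blast
    qed
    show "range (\<lambda>v. v * W) \<noteq> {0}"
      using \<open>W \<noteq> 0\<close> by (metis UNIV_I imageI mult_1_left singletonD)
  qed auto
  then obtain L where L: "good L" and min: "\<And>M. good M \<Longrightarrow> dim L \<le> dim M"
    using ex_has_least_nat[of good _ dim] by metis
  have sL: "subspace L" and left: "\<And>a l. l \<in> L \<Longrightarrow> a * l \<in> L" and right: "\<And>l. l \<in> L \<Longrightarrow> l * x \<in> L"
    and nz: "L \<noteq> {0}" and LW: "L \<subseteq> range (\<lambda>v. v * W)"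
    using L by (auto simp: good_def)
  obtain l0 where l0: "l0 \<in> L" "l0 \<noteq> 0"
    using nz subspace_0[OF sL] by blast
  obtain a l where a: "a \<in> L" "a * x = - (x * a)" "l \<in> L" "l * a \<noteq> 0"
    using exists_odd_element[of L, OF left right subspace_diff[OF sL] l0] by metis
  define M where "M = (\<lambda>z. z * a) ` L"
  have "good M"
    unfolding good_def
  proof (intro conjI ballI allI)
    show "subspace M" unfolding M_def by (rule subspace_mult_right_image[OF sL])
    show "b * l \<in> M" if "l \<in> M" for b l
      using that left by (auto simp: M_def mult.assoc[symmetric])
    show "m * x \<in> M" if m: "m \<in> M" for m
    proof -
      obtain z where z: "z \<in> L" "m = z * a" using m by (auto simp: M_def)
      then have "m * x = (- 1 * (z * x)) * a" using a(2) by (simp add: mult.assoc)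
      then show ?thesis unfolding M_def using left[OF right[OF z(1)]] by blast
    qed
    show "M \<noteq> {0}" using a by (auto simp: M_def)
    show "M \<subseteq> range (\<lambda>v. v * W)" using left[OF a(1)] LW by (auto simp: M_def)
  qed
  moreover have "M \<subseteq> L" using left[OF a(1)] by (auto simp: M_def)
  moreover have "subspace M" using \<open>good M\<close> by (simp add: good_def)
  ultimately have M_eq: "M = L"
    using min dim_psubset_subspace[of M L] sL by fastforce
  have "(\<lambda>z. z * a ^ m) ` L = L" for m
  proof (induction m)
    case (Suc m)
    have "(\<lambda>z. z * a ^ Suc m) ` L = (\<lambda>z. z * a ^ m) ` ((\<lambda>z. z * a) ` L)"
      by (simp add: image_image mult.assoc)
    then show ?case using Suc M_eq by (simp add: M_def)
  qed simp
  then have "a ^ m \<noteq> 0" for m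
    using l0 by (metis imageE mult_zero_right)
  moreover obtain v where "a = v * W" using a(1) LW by auto
  ultimately show thesis using that[of v] a(2) by simp
qed

lemma exists_odd_commuting_nonnilpotent:
  assumes e: "e * e = e" "e \<noteq> 0" "e * x = x * e" "e * c = c" "c * e = c"
    and c: "c * x = - (x * c)" "c ^ N = 0"
  obtains u where "e * u = u" "u * e = u" "u * x = - (x * u)" "u * c = c * u" "\<And>m. u ^ m \<noteq> 0"
proof -
  have "\<exists>n. e * c ^ n \<noteq> 0 \<and> c ^ Suc n = 0"
  proof -
    define k where "k = (LEAST k. e * c ^ k = 0)"
    have k: "e * c ^ k = 0" "\<And>j. j < k \<Longrightarrow> e * c ^ j \<noteq> 0"
      unfolding k_def using c(2) by (auto intro: LeastI[of _ N] dest: not_less_Least)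
    then obtain n where n: "k = Suc n" using e(2) by (cases k) auto
    have "c ^ Suc n = e * c ^ Suc n" using e(4) by (simp add: mult.assoc[symmetric])
    then show ?thesis using k(1) k(2)[of n] n by auto
  qed
  then obtain n where n: "e * c ^ n \<noteq> 0" "c ^ Suc n = 0" by blast
  \<comment> \<open>The factor \<open>e\<close> matters only for \<open>c = 0\<close>: then
    \<open>n = 0\<close>, and \<open>c ^ n\<close> is \<open>1\<close> rather than the unit
    \<open>e\<close> of the corner.\<close>
  define W where "W = e * c ^ n"
  have ecn: "e * c ^ j = c ^ j * e" for j
    using e(4,5) by (metis power_commuting_commutes)
  have cx: "c ^ j * x = x * c ^ j \<or> c ^ j * x = - (x * c ^ j)" for j
  proof (induction j)
    case (Suc j)
    have "c ^ Suc j * x = c * (c ^ j * x)" by (simp add: mult.assoc)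
    with Suc have "c ^ Suc j * x = (c * x) * c ^ j \<or> c ^ Suc j * x = - ((c * x) * c ^ j)"
      by (auto simp: mult.assoc)
    then show ?case using c(1) by (auto simp: mult.assoc)
  qed simp
  have Wx: "W * x = x * W \<or> W * x = - (x * W)"
    using cx[of n] e(3) unfolding W_def by (metis mult.assoc mult_minus_right)
  have eW: "e * W = W" using e(1) by (simp add: W_def mult.assoc[symmetric])
  have We: "W * e = W" using e(1) ecn by (metis W_def mult.assoc)
  have cW: "c * W = 0" using n(2) e(5) by (simp add: W_def mult.assoc[symmetric])
  obtain v where v: "v * W * x = - (x * (v * W))" "\<And>m. (v * W) ^ m \<noteq> 0"
    using exists_odd_nonnilpotent_multiple[OF n(1)[folded W_def] Wx] by metis
  text \<open>With \<open>j\<close> terms the sum of the \<open>c\<^sup>i v c\<^sup>j\<^sup>-\<^sup>1\<^sup>-\<^sup>i\<close> qualifies.\<close>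
  have "\<exists>s. c * s - s * c = c ^ j * v - v * c ^ j" for j
  proof (induction j)
    case 0
    show ?case by (auto intro: exI[of _ 0])
  next
    case (Suc j)
    then obtain s where s: "c * s - s * c = c ^ j * v - v * c ^ j" by blast
    have "c * (s * c + c ^ j * v) - (s * c + c ^ j * v) * c
        = (c * s - s * c) * c + c ^ Suc j * v - c ^ j * v * c"
      by (simp add: algebra_simps)
    also have "\<dots> = c ^ Suc j * v - v * c ^ Suc j"
      unfolding s by (simp add: algebra_simps power_commutes)
    finally show ?case by blast
  qed
  then obtain s where s: "c * s - s * c = c ^ n * v - v * c ^ n" by blast
  \<comment> \<open>If \<open>s\<close> is the sum with \<open>n\<close> terms, this is the one with
    \<open>n + 1\<close> terms; its commutator with \<open>c\<close> vanishes as
    \<open>c ^ Suc n = 0\<close>.\<close>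
  define u0 where "u0 = s * c + c ^ n * v"
  have "c * u0 - u0 * c = (c * s - s * c) * c + c ^ Suc n * v - c ^ n * v * c"
    by (simp add: u0_def algebra_simps)
  also have "\<dots> = c ^ Suc n * v - v * c ^ Suc n"
    unfolding s by (simp add: algebra_simps power_commutes)
  finally have u0c: "c * u0 = u0 * c" using n(2) by simp
  define u1 where "u1 = e * u0 * e"
  have u1c: "c * u1 = u1 * c"
    using u0c e(4,5) unfolding u1_def by (metis mult.assoc)
  have eu1: "e * u1 = u1" and u1e: "u1 * e = u1"
    using e(1) by (simp_all add: u1_def mult.assoc) (simp add: mult.assoc[symmetric])
  \<comment> \<open>Only the term \<open>c ^ n * v\<close> of \<open>u0\<close> contributes, because
    \<open>c * W = 0\<close>.\<close>
  have u1W: "u1 * W = W * (v * W)"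
    using eW cW unfolding u1_def u0_def by (simp add: algebra_simps) (simp add: W_def algebra_simps)
  \<comment> \<open>The odd part of \<open>u1\<close>: the inverse of \<open>x\<close> is
    \<open>x / t\<close>, so this is half the difference of \<open>u1\<close> and its conjugate by
    \<open>x\<close>.\<close>
  define u where "u = scale (inverse 2) (u1 - scale (inverse t) (x * u1 * x))"
  \<comment> \<open>Moving \<open>x\<close> past \<open>W\<close> happens twice with the same sign,
    past the odd \<open>v * W\<close> once. So taking the odd part of \<open>u1\<close> does not
    change its product with \<open>W\<close>.\<close>
  have xux: "scale (inverse t) (x * u1 * x) * W = - (W * (v * W))"
  proof -
    have "x * u1 * x * W = - (x * x * W * (v * W))"
      using Wx
    proof
      assume a: "W * x = x * W"
      have "x * u1 * x * W = x * (u1 * W) * x" using a by (metis mult.assoc)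
      also have "\<dots> = x * W * (v * W * x)" by (simp add: u1W mult.assoc)
      also have "\<dots> = - (x * (W * x) * (v * W))" by (simp add: v(1)[unfolded mult.assoc] mult.assoc)
      finally show ?thesis by (simp add: a mult.assoc)
    next
      assume a: "W * x = - (x * W)"
      have "x * u1 * x * W = - (x * (u1 * W) * x)" using a
        by (simp add: mult.assoc)
      also have "\<dots> = - (x * W * (v * W * x))" by (simp add: u1W mult.assoc)
      also have "\<dots> = x * (W * x) * (v * W)" by (simp add: v(1)[unfolded mult.assoc] mult.assoc)
      finally show ?thesis by (simp add: a mult.assoc)
    qed
    then show ?thesis using t_nz by (simp add: sq mult_scale_left)
  qed
  have uW: "u * W = W * (v * W)"
  proof -
    have "u * W = scale (inverse 2) (W * (v * W) + W * (v * W))"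
      unfolding u_def by (simp add: mult_scale_left left_diff_distrib u1W)
         (use xux in \<open>simp add: mult_scale_left\<close>)
    also have "\<dots> = scale (inverse 2 * 2) (W * (v * W))"
      by (metis scale_left_distrib one_add_one scale_one scale_scale)
    finally show ?thesis using two by simp
  qed
  have "u ^ m * W = W * (v * W) ^ m" for m
  proof (induction m)
    case (Suc m)
    have "u ^ Suc m * W = u * (u ^ m * W)" by (simp add: mult.assoc)
    also have "\<dots> = u * W * (v * W) ^ m" by (simp only: Suc mult.assoc)
    finally show ?case by (simp add: uW mult.assoc)
  qed simp
  then have unil: "u ^ m \<noteq> 0" for m
    using v(2)[of "Suc m"] by (metis mult.assoc mult_zero_left mult_zero_right power_Suc)
  have "x * u1 * x * c = c * (x * u1 * x)"
  proof -
    have xc: "x * c = - (c * x)" using c(1) by simp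
    have "x * u1 * x * c = - (x * (u1 * c) * x)" by (simp add: mult.assoc xc)
    also have "\<dots> = - (x * c * u1 * x)" by (simp add: mult.assoc u1c)
    finally show ?thesis by (simp add: mult.assoc xc)
  qed
  then have uc: "u * c = c * u"
    by (simp add: u_def mult_scale_left mult_scale_right algebra_simps u1c)
  have ux: "u * x = - (x * u)"
    using t_nz by (simp add: u_def mult_scale_left mult_scale_right algebra_simps sq sq_left)
  have "e * (x * u1 * x) = x * u1 * x" "x * u1 * x * e = x * u1 * x"
    using eu1 u1e e(3) by (metis mult.assoc)+
  then have "e * u = u" "u * e = u"
    by (simp_all add: u_def mult_scale_left mult_scale_right right_diff_distrib left_diff_distrib eu1 u1e)
  then show thesis using that uc ux unil by blast
qed

section \<open>Elements and units exchanging two square roots of \<open>t\<close>\<close>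

text \<open>Since \<open>x * x = y * y\<close>, the element \<open>x + y\<close> swaps
  \<open>x\<close> and \<open>y\<close>, while \<open>x - y\<close> swaps them up to a minus sign,
  which an odd factor \<open>u\<close> removes.\<close>

lemma exists_nonnilpotent_swap:
  assumes y: "y * y = scale t 1"
    and f: "f * f = f" "f \<noteq> 0" "f * x = x * f" "f * y = y * f"
  obtains h where "f * h = h" "h * f = h" "h * x = y * h" "h * y = x * h" "\<And>m. h ^ m \<noteq> 0"
proof (cases "\<forall>m. (f * (x + y)) ^ m \<noteq> 0")
  case True
  have "f * (f * (x + y)) = f * (x + y)"
    using f(1) by (simp add: mult.assoc[symmetric])
  moreover have "(x + y) * f = f * (x + y)"
    using f by (simp add: algebra_simps)
  moreover from this have "f * (x + y) * f = f * (x + y)"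
    using f(1) by (metis mult.assoc)
  moreover have "f * (x + y) * x = y * (f * (x + y))"
  proof -
    have "f * (x + y) * x = f * (y * (x + y))"
      by (simp add: mult.assoc) (simp add: algebra_simps sq y)
    then show ?thesis using f(4) by (simp add: mult.assoc[symmetric])
  qed
  moreover have "f * (x + y) * y = x * (f * (x + y))"
  proof -
    have "f * (x + y) * y = f * (x * (x + y))"
      by (simp add: mult.assoc) (simp add: algebra_simps sq y)
    then show ?thesis using f(3) by (simp add: mult.assoc[symmetric])
  qed
  ultimately show thesis using that True by blast
next
  case False
  then obtain m where m: "(f * (x + y)) ^ m = 0" by auto
  text \<open>Replacing \<open>y\<close> by \<open>- x\<close> outside the corner of \<open>f\<close> makes \<open>x + y'\<close> nilpotent and
    \<open>x - y'\<close> invertible in the whole algebra.\<close>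
  define y' where "y' = f * y - (1 - f) * x"
  define N where "N = x + y'"
  define D where "D = x - y'"
  have fy': "f * y' = f * y" and y'f: "y' * f = y * f"
    using f by (simp_all add: y'_def algebra_simps)
      (simp_all add: mult.assoc[symmetric], metis f(1) f(4) mult.assoc)
  have fl: "f * (f * z) = f * z" for z using f(1) by (simp add: mult.assoc[symmetric])
  have xf: "x * (f * z) = f * (x * z)" for z using f(3) by (metis mult.assoc)
  have yf: "y * (f * z) = f * (y * z)" for z using f(4) by (metis mult.assoc)
  have y'2: "y' * y' = scale t 1"
    by (simp add: y'_def algebra_simps sq y fl xf yf f(3)[symmetric])
  have N_eq: "N = f * (x + y)" by (simp add: N_def y'_def algebra_simps)
  have Nm: "N ^ m = 0" using m N_eq by simp
  have xN: "x * N = N * y'" and y'N: "y' * N = N * x"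
    by (simp_all add: N_def algebra_simps sq y'2)
  have Dx: "D * x = - (y' * D)" and Dy': "D * y' = - (x * D)"
    by (simp_all add: D_def algebra_simps sq y'2)
  have ND: "N * D = - (D * N)"
    by (simp add: D_def N_def algebra_simps sq y'2)
  have fD: "f * D = D * f"
    using f(3,4) fy' y'f by (simp add: D_def algebra_simps)
  have fN: "f * N = N" by (simp add: N_eq fl)
  have Nf: "N * f = N" using f by (simp add: N_eq algebra_simps xf[symmetric] yf[symmetric])
  have t4: "4 * t \<noteq> 0"
    using two t_nz by (metis mult_eq_0_iff numeral_times_numeral semiring_norm(12) semiring_norm(13))
  \<comment> \<open>Chosen so that \<open>D * D = 4 t (1 - p)\<close>, from
    \<open>D * D + N * N = 4 t\<close>. As \<open>p\<close> is nilpotent, \<open>D\<close> is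
    invertible.\<close>
  define p where "p = scale (inverse (4 * t)) (N * N)"
  have "(N * N) ^ m = N ^ m * N ^ m"
    by (metis mult_2 power2_eq_square power_add power_mult)
  then have "p ^ m = 0" using Nm by (simp add: p_def scale_power)
  then obtain r where r: "(1 - p) * r = 1" "r * (1 - p) = 1"
    using one_minus_nilpotent_invertible by metis
  have D2: "D * D = scale (4 * t) (1 - p)"
  proof -
    have "D * D + N * N = scale (4 * t) 1"
    proof -
      have "D * D + N * N = scale t 1 + scale t 1 + (scale t 1 + scale t 1)"
        by (simp add: D_def N_def algebra_simps sq y'2)
      also have "\<dots> = scale (t + t + (t + t)) 1" by (simp only: scale_left_distrib)
      finally show ?thesis by simp
    qed
    then show ?thesis using t4 unfolding p_def
      by (simp add: scale_right_diff_distrib algebra_simps)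
  qed
  define R where "R = scale (inverse (4 * t)) r"
  have "D * (D * R) = 1" "(R * D) * D = 1"
    using D2 r t4 by (simp_all add: R_def mult.assoc[symmetric] mult_scale_right mult_scale_left)
      (simp_all add: mult.assoc mult_scale_right mult_scale_left)
  then obtain Di where Di: "D * Di = 1" "Di * D = 1"
    by (metis mult.assoc mult_1_left mult_1_right)
  define c where "c = N * Di"
  have cD: "c * D = N" by (simp add: c_def mult.assoc Di)
  have fDi: "f * Di = Di * f" using fD Di by (metis mult.assoc mult_1_left mult_1_right)
  have fc: "f * c = c" by (simp add: c_def fN mult.assoc[symmetric])
  have cf: "c * f = c" using fDi Nf by (metis c_def mult.assoc)
  have NDi: "N * Di = - (Di * N)"
    using ND Di by (metis minus_minus mult.assoc mult_1_left mult_1_right mult_minus_left mult_minus_right)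
  have cnil: "c ^ (2 * m) = 0"
    unfolding c_def by (rule anticommuting_nilpotent[OF NDi Nm])
  have "c * x * D = - (x * c) * D"
  proof -
    have "x * D = - (D * y')" using Dy' by simp
    then have "c * x * D = - (c * D * y')" by (simp add: mult.assoc)
    also have "\<dots> = - (x * c) * D" by (simp add: cD xN[symmetric] mult.assoc)
    finally show ?thesis .
  qed
  then have cx: "c * x = - (x * c)" using Di by (metis mult.assoc mult_1_right)
  obtain u where u: "f * u = u" "u * f = u" "u * x = - (x * u)" "u * c = c * u" "\<And>m. u ^ m \<noteq> 0"
    using exists_odd_commuting_nonnilpotent[OF f(1-3) fc cf cx cnil] by metis
  text \<open>The Cayley transform \<open>c = (x + y') / (x - y')\<close> determines \<open>y'\<close> from \<open>x\<close>,
    so \<open>u\<close> anticommutes with \<open>y'\<close> as well.\<close>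
  have cay: "(1 + c) * y' = (c - 1) * x"
    using cD by (simp add: D_def N_def algebra_simps)
  have uy': "u * y' = - (y' * u)"
  proof -
    have "(- c) ^ (2 * m) = 0" using cnil by simp
    then obtain s where s: "s * (1 - (- c)) = 1"
      using one_minus_nilpotent_invertible by metis
    have "(1 + c) * (u * y') = u * ((1 + c) * y')"
      using u(4) by (simp add: algebra_simps) (metis mult.assoc)
    also have "\<dots> = (c - 1) * (u * x)"
      using u(4) unfolding cay by (simp add: algebra_simps) (metis mult.assoc)
    also have "\<dots> = - ((c - 1) * x * u)" by (simp add: u(3) mult.assoc)
    also have "\<dots> = (1 + c) * (- (y' * u))" by (simp add: cay[symmetric] mult.assoc)
    finally have "s * ((1 + c) * (u * y')) = s * ((1 + c) * (- (y' * u)))" by simp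
    then show ?thesis using s by (simp add: mult.assoc[symmetric])
  qed
  define h where "h = D * u"
  have fh: "f * h = h" using u(1) fD by (metis h_def mult.assoc)
  have hf: "h * f = h" by (simp add: h_def mult.assoc u(2))
  \<comment> \<open>The signs from \<open>u\<close> and \<open>D\<close> cancel, and
    \<open>y'\<close> agrees with \<open>y\<close> on the corner of \<open>f\<close>, where
    \<open>h\<close> lies.\<close>
  have hx: "h * x = y * h"
  proof -
    have "h * x = - (D * x * u)" by (simp add: h_def mult.assoc u(3))
    also have "\<dots> = y' * h" by (simp add: Dx h_def mult.assoc)
    also have "\<dots> = y * h" using fh y'f by (metis mult.assoc)
    finally show ?thesis .
  qed
  have hy: "h * y = x * h"
  proof -
    have "h * y = h * y'" using hf fy' by (metis mult.assoc)
    also have "\<dots> = - (D * y' * u)" by (simp add: h_def mult.assoc uy')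
    also have "\<dots> = x * h" by (simp add: Dy' h_def mult.assoc)
    finally show ?thesis .
  qed
  \<comment> \<open>\<open>D\<close> and \<open>u\<close> anticommute, so \<open>u\<close> is the
    product of the anticommuting elements \<open>h\<close> and \<open>- Di\<close>; a nilpotent
    \<open>h\<close> would make \<open>u\<close> nilpotent.\<close>
  have "h ^ j \<noteq> 0" for j
  proof
    assume j: "h ^ j = 0"
    have "D * u = - (u * D)" by (simp add: D_def algebra_simps u(3) uy')
    moreover have "Di * h = u" using Di by (simp add: h_def mult.assoc[symmetric])
    ultimately have "Di * h = u" "h = - (u * D)" by (simp_all add: h_def)
    then have 1: "u = h * (- Di)" using Di by (simp add: mult.assoc)
    then have "h * (- Di) = - (- Di * h)" using \<open>Di * h = u\<close> by simp
    from anticommuting_nilpotent[OF this j] show False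
      using u(5) 1 by metis
  qed
  then show thesis using that fh hf hx hy by blast
qed

text \<open>Among the idempotents \<open>e\<close> whose corner has a swapping unit, take one with
  \<open>e A\<close> of largest dimension. If \<open>e \<noteq> 1\<close>, Fitting's lemma for the
  square of a non-nilpotent swap \<open>g\<close> in the corner of \<open>1 - e\<close> yields an
  idempotent \<open>i \<noteq> 0\<close> on which \<open>g\<close> is invertible, and
  \<open>e + i\<close> is larger.\<close>

lemma exists_unit_swap:
  assumes y: "y * y = scale t 1"
  obtains h h' where "h * h' = 1" "h' * h = 1" "h * x = y * h" "h * y = x * h"
proof -
  \<comment> \<open>\<open>h'\<close> is the inverse of \<open>h\<close> in the corner ring
    \<open>e A e\<close>, whose unit is \<open>e\<close>.\<close>
  define swap where "swap e h h' \<longleftrightarrow> e * h = h \<and> h * e = h \<and> e * h' = h' \<and> h' * e = h' \<and>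
    h * h' = e \<and> h' * h = e \<and> h * x = y * h \<and> h * y = x * h" for e h h'
  define P where "P e \<longleftrightarrow> e * e = e \<and> e * x = x * e \<and> e * y = y * e \<and> (\<exists>h h'. swap e h h')" for e
  define fix_dim where "fix_dim e = dim {a. e * a = a}" for e
  have "P 0" by (auto simp: P_def swap_def)
  moreover have "\<forall>e. P e \<longrightarrow> fix_dim e < Suc (dim UNIV)"
    unfolding fix_dim_def less_Suc_eq_le
    using dim_psubset_subspace[OF subspace_fixed_left subspace_UNIV]
    by (metis less_imp_le order_refl psubsetI subset_UNIV)
  ultimately obtain e where e: "P e" and max: "\<And>e'. P e' \<Longrightarrow> fix_dim e' \<le> fix_dim e"
    using ex_has_greatest_nat[of P 0 fix_dim] by blast
  obtain h h' where sw: "swap e h h'" using e by (auto simp: P_def)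
  have ee: "e * e = e" and ex: "e * x = x * e" and ey: "e * y = y * e"
    using e by (auto simp: P_def)
  have "e = 1"
  proof (rule ccontr)
    assume "e \<noteq> 1"
    define f where "f = 1 - e"
    have f: "f * f = f" "f \<noteq> 0" "f * x = x * f" "f * y = y * f"
      using ee ex ey \<open>e \<noteq> 1\<close> by (auto simp: f_def algebra_simps)
    obtain g where g: "f * g = g" "g * f = g" "g * x = y * g" "g * y = x * g" "\<And>m. g ^ m \<noteq> 0"
      using exists_nonnilpotent_swap[OF y f] by metis
    define a where "a = g * g"
    have ax: "x * a = a * x" and ay: "y * a = a * y" and ag: "g * a = a * g" and af: "f * a = a * f"
      and fa: "f * a = a"
      using g by (auto simp: a_def) (metis mult.assoc)+
    have anz: "a ^ n \<noteq> 0" for n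
      using g(5)[of "2 * n"] by (simp add: a_def power_mult power2_eq_square)
    obtain b n where b: "\<And>z. z * a = a * z \<Longrightarrow> z * b = b * z" and n: "a ^ n = a ^ Suc n * b"
      using fitting[of a] by metis
    have ba: "a * b = b * a" using b by simp
    \<comment> \<open>A positive exponent lets \<open>a\<close> be split off from
      \<open>i = a ^ k * b ^ k\<close> below, even for \<open>n = 0\<close>; the cofactor
      \<open>d\<close> inverts \<open>a\<close> on the corner of \<open>i\<close>.\<close>
    define k where "k = Suc n"
    have k: "a ^ k = a ^ Suc k * b" using n by (simp add: k_def mult.assoc)
    \<comment> \<open>The case \<open>j = k\<close> becomes \<open>a ^ k * i = a ^ k\<close>, so
      \<open>i\<close> is a nonzero idempotent.\<close>
    have ak: "a ^ k = a ^ (k + j) * b ^ j" for j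
    proof (induction j)
      case (Suc j)
      have "a ^ (k + Suc j) = a ^ j * a ^ Suc k"
        by (simp only: power_add[symmetric] add_Suc_right add.commute)
      then have "a ^ (k + Suc j) * b ^ Suc j = a ^ j * (a ^ Suc k * b) * b ^ j"
        by (simp only: power_Suc[of b] mult.assoc)
      also have "\<dots> = a ^ (k + j) * b ^ j" by (simp only: k[symmetric] power_add[symmetric] add.commute)
      finally show ?case using Suc by simp
    qed simp
    define d where "d = a ^ n * b ^ k"
    define i where "i = a ^ k * b ^ k"
    have comm: "z * i = i * z \<and> z * d = d * z" if "z * a = a * z" for z
    proof -
      have "z * a ^ j = a ^ j * z" "z * b ^ j = b ^ j * z" for j
        using that b[OF that] by (metis power_commuting_commutes)+
      then show ?thesis unfolding i_def d_def by (metis mult.assoc)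
    qed
    have i_ad: "i = a * d" by (simp add: i_def d_def k_def mult.assoc)
    have aki: "a ^ k * i = a ^ k"
      using ak[of k] by (simp add: i_def power_add mult.assoc)
    have ii: "i * i = i"
    proof -
      have "i * i = i * (a ^ k * b ^ k)" by (simp add: i_def)
      also have "\<dots> = a ^ k * i * b ^ k"
        using comm[of "a ^ k"] by (metis mult.assoc power_commutes)
      finally show ?thesis using aki by (simp add: i_def)
    qed
    have "i \<noteq> 0" using aki anz by (metis mult_zero_right)
    have ix: "i * x = x * i" and iy: "i * y = y * i" and ig: "i * g = g * i" and dg: "d * g = g * d"
      and fi: "f * i = i" and "i * f = i" and di: "d * i = i * d"
      using comm[OF ax] comm[OF ay] comm[OF ag] comm[OF af] fa comm[of i] comm[of a]
      by (auto simp: i_ad mult.assoc[symmetric]) (metis mult.assoc)+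
    have ei: "e * i = 0" and ie: "i * e = 0"
      using fi \<open>i * f = i\<close> by (auto simp: f_def algebra_simps)
    define g2 where "g2 = g * i"
    define g2' where "g2' = g * d * i"
    have il: "i * (i * z) = i * z" for z using ii by (simp add: mult.assoc[symmetric])
    have g2: "i * g2 = g2" "g2 * i = g2" "i * g2' = g2'" "g2' * i = g2'"
      unfolding g2_def g2'_def using ii il ig di by (metis mult.assoc)+
    have g2g2': "g2 * g2' = i" "g2' * g2 = i"
    proof -
      have "g2 * g2' = (g * g) * d * (i * i)" "g2' * g2 = (g * g) * d * (i * i)"
        unfolding g2_def g2'_def using ig dg di by (metis mult.assoc)+
      then show "g2 * g2' = i" "g2' * g2 = i" by (simp_all add: a_def[symmetric] i_ad[symmetric] ii)
    qed
    have g2x: "g2 * x = y * g2" and g2y: "g2 * y = x * g2"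
      unfolding g2_def using ix iy g(3,4) by (metis mult.assoc)+
    \<comment> \<open>Orthogonality of the two corners: sums of swaps multiply blockwise.\<close>
    have cross: "z * w = 0 \<and> w * z = 0" if "e * z = z" "z * e = z" "i * w = w" "w * i = w" for z w
      using that ei ie by (metis mult.assoc mult_zero_left mult_zero_right)
    have "swap (e + i) (h + g2) (h' + g2')"
      using sw g2 g2g2' g2x g2y cross[of h g2'] cross[of h' g2] cross[of h i] cross[of h' i]
        cross[of e g2] cross[of e g2'] ee ii
      unfolding swap_def by (simp add: distrib_left distrib_right)
    then have "P (e + i)"
      unfolding P_def using ee ii ei ie ex ey ix iy
      by (auto simp: distrib_left distrib_right)
    moreover have "fix_dim e < fix_dim (e + i)"
      unfolding fix_dim_def
    proof (rule dim_psubset_subspace[OF subspace_fixed_left subspace_fixed_left])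
      have "(e + i) * z = z" if "e * z = z" for z
        using that ie by (metis add.right_neutral distrib_right mult.assoc mult_zero_left)
      moreover have "(e + i) * i = i" "e * i \<noteq> i"
        using ei ii \<open>i \<noteq> 0\<close> by (auto simp: distrib_right)
      ultimately show "{z. e * z = z} \<subset> {z. (e + i) * z = z}" by blast
    qed
    ultimately show False using max by force
  qed
  then show thesis using that sw by (auto simp: swap_def)
qed

end

section \<open>Square-root generators of quadratic extensions\<close>

text \<open>Completing the square needs only \<open>2 \<noteq> 0\<close>. If
  \<open>t = c * c\<close>, then \<open>(d - c) (d + c) = 0\<close> in a field would put
  \<open>d\<close> into the base field.\<close>

lemma (in quadratic_extension) exists_root_generator:
  assumes two: "(2::'f) \<noteq> 0"
  obtains d t where "d * d = scale t 1" "\<And>c. c * c \<noteq> t" "\<And>z. \<exists>a b. z = scale a 1 + scale b d"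
proof -
  obtain B where B: "independent B" "UNIV \<subseteq> span B" "card B = 2"
    using basis_exists[of UNIV] degree by metis
  then have "finite B" using card.infinite by force
  with B interpret fd: finite_dimensional_vector_space scale B
    by unfold_locales auto
  have i1: "independent {1}" by (simp add: independent_insert independent_empty)
  obtain \<alpha> where \<alpha>: "\<alpha> \<notin> span {1}"
  proof -
    have "span {1} \<noteq> UNIV"
      using dim_eq_card[of "{1}" UNIV] i1 degree by auto
    then show thesis using that by blast
  qed
  then have "independent {\<alpha>, 1}" and "\<alpha> \<noteq> 1"
    using i1 span_base[of 1 "{1}"] by (auto simp: independent_insert)
  then have "UNIV \<subseteq> span {\<alpha>, 1}"
    using fd.card_eq_dim[of "{\<alpha>, 1}" UNIV] degree by auto
  then have "\<exists>b. z - scale b \<alpha> \<in> span {1}" for z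
    using span_breakdown_eq[of z \<alpha> "{1}"] by blast
  then have "\<exists>a b. z - scale b \<alpha> = scale a 1" for z
    unfolding span_singleton by blast
  then have gen: "\<exists>a b. z = scale a 1 + scale b \<alpha>" for z
    unfolding diff_eq_eq .
  obtain p q where pq: "\<alpha> * \<alpha> = scale p 1 + scale q \<alpha>" using gen by blast
  define d where "d = \<alpha> - scale (q / 2) 1"
  have q2: "scale (q / 2) z + scale (q / 2) z = scale q z" for z
    using two by (simp add: scale_left_distrib[symmetric] field_simps)
  have "d * d = scale p 1 + scale q \<alpha> - (scale (q / 2) \<alpha> + scale (q / 2) \<alpha>) + scale (q / 2 * (q / 2)) 1"
    by (simp add: d_def algebra_simps mult_scale_left mult_scale_right pq)
  then have dd: "d * d = scale (p + q / 2 * (q / 2)) 1"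
    by (simp only: q2 scale_left_distrib) simp
  have nd: "d \<noteq> scale c 1" for c
  proof
    assume "d = scale c 1"
    then have "\<alpha> = scale (c + q / 2) 1" by (simp add: d_def scale_left_distrib algebra_simps)
    then show False using \<alpha> by (auto simp: span_singleton)
  qed
  have "c * c \<noteq> p + q / 2 * (q / 2)" for c
  proof
    assume c: "c * c = p + q / 2 * (q / 2)"
    have "(d - scale c 1) * (d + scale c 1) = d * d - scale (c * c) 1"
      by (simp add: algebra_simps mult_scale_left mult_scale_right)
    then have "(d - scale c 1) * (d + scale c 1) = 0"
      unfolding dd c by simp
    then have "d = scale c 1 \<or> d = scale (- c) 1" by (auto simp: eq_neg_iff_add_eq_0)
    then show False using nd by blast
  qed
  moreover have "\<exists>a b. z = scale a 1 + scale b d" for z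
  proof -
    obtain a b where "z = scale a 1 + scale b \<alpha>" using gen by blast
    also have "\<dots> = scale (a + b * (q / 2)) 1 + scale b d"
      by (simp add: d_def scale_left_distrib scale_right_diff_distrib)
    finally show ?thesis by blast
  qed
  ultimately show thesis using that dd by blast
qed

section \<open>Inverses, centralizers and double cosets\<close>

lemma unit_inv_eqI:
  assumes "g * h = 1" "h * g = 1"
  shows "unit_inv g = h"
proof -
  have "g \<in> unit_group" using assms by (auto simp: unit_group_def)
  then have "unit_inv g * (g * h) = h"
    using unit_inv(2)[of g] by (simp add: mult.assoc[symmetric])
  then show ?thesis using assms by simp
qed

lemma unit_inv_centralizer:
  assumes "h \<in> centralizer unit_group X"
  shows "unit_inv h \<in> centralizer unit_group X"
proof -
  have h: "h \<in> unit_group" and comm: "\<And>z. z \<in> X \<Longrightarrow> h * z = z * h"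
    using assms by (auto simp: centralizer_def)
  have "unit_inv h \<in> unit_group" using unit_inv[OF h] by (auto simp: unit_group_def)
  moreover have "unit_inv h * z = z * unit_inv h" if "z \<in> X" for z
    using unit_inv[OF h] comm[OF that] by (metis mult.assoc mult_1_left mult_1_right)
  ultimately show ?thesis by (auto simp: centralizer_def)
qed

lemma unit_group_mult:
  assumes "g \<in> unit_group" "h \<in> unit_group"
  shows "g * h \<in> unit_group" and "unit_inv (g * h) = unit_inv h * unit_inv g"
proof -
  have "g * h * (unit_inv h * unit_inv g) = 1" "unit_inv h * unit_inv g * (g * h) = 1"
    using unit_inv[OF assms(1)] unit_inv[OF assms(2)] by (metis mult.assoc mult_1_right)+
  then show "g * h \<in> unit_group" "unit_inv (g * h) = unit_inv h * unit_inv g"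
    using unit_inv_eqI by (auto simp: unit_group_def)
qed

lemma centralizer_mult:
  assumes "g \<in> centralizer unit_group X" "h \<in> centralizer unit_group X"
  shows "g * h \<in> centralizer unit_group X"
  using assms by (auto simp: centralizer_def unit_group_mult) (metis mult.assoc)

text \<open>The inverse of \<open>h * g * k\<close> is
  \<open>k\<^sup>-\<^sup>1 g\<^sup>-\<^sup>1 h\<^sup>-\<^sup>1\<close>, so the inverse of the
  representative decides.\<close>

lemma double_coset_inv_subset:
  assumes H: "H = centralizer unit_group X" and g: "g \<in> unit_group"
    and inv: "unit_inv g \<in> double_coset H g"
  shows "unit_inv ` double_coset H g \<subseteq> double_coset H g"
proof
  fix z assume "z \<in> unit_inv ` double_coset H g"
  then obtain h k where hk: "h \<in> H" "k \<in> H" "z = unit_inv (h * g * k)"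
    by (auto simp: double_coset_def)
  obtain h' k' where h': "h' \<in> H" "k' \<in> H" "unit_inv g = h' * g * k'"
    using inv by (auto simp: double_coset_def)
  have "h \<in> unit_group" "k \<in> unit_group" using hk H by (auto simp: centralizer_def)
  then have "z = unit_inv k * (unit_inv g * unit_inv h)"
    using g by (simp add: hk unit_group_mult)
  then have "z = (unit_inv k * h') * g * (k' * unit_inv h)" by (simp add: h' mult.assoc)
  moreover have "unit_inv k * h' \<in> H" "k' * unit_inv h \<in> H"
    using hk h' unfolding H by (auto intro: centralizer_mult unit_inv_centralizer)
  ultimately show "z \<in> double_coset H g" by (auto simp: double_coset_def)
qed

section \<open>Inversion on the double cosets of the centralizer of \<open>E\<close>\<close>

theorem theorem4p8:
  fixes v :: "'f::field \<Rightarrow> real"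
    and scaleE :: "'f \<Rightarrow> 'e::field \<Rightarrow> 'e"
    and scaleA :: "'f \<Rightarrow> 'a::ring_1 \<Rightarrow> 'a"
    and \<iota> :: "'e \<Rightarrow> 'a"
    and G H :: "'a set"
  assumes "nonarch_local_field v"
    and "CHAR('f) \<noteq> 2"
    and "quadratic_extension scaleE"
    and "central_simple_algebra scaleA"
    and "even (vector_space.dim scaleA UNIV)"
    and "algebra_embedding scaleE scaleA \<iota>"
    and "G = unit_group"
    and "H = centralizer G (\<iota> ` (UNIV - {0}))"
  shows "\<forall>g\<in>G. unit_inv ` double_coset H g = double_coset H g"
proof
  fix g assume "g \<in> G"
  then have g: "g \<in> unit_group" using assms by simp
  interpret Q: quadratic_extension scaleE by fact
  interpret A: central_simple_algebra scaleA by fact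
  interpret emb: algebra_embedding scaleE scaleA \<iota> by fact
  have two: "(2::'f) \<noteq> 0"
  proof
    assume "(2::'f) = 0"
    then have "CHAR('f) dvd 2" using of_nat_eq_0_iff_char_dvd[where ?'a = 'f, of 2] by simp
    then have "CHAR('f) = 1"
      using assms(2) by (metis prime_nat_iff two_is_prime_nat)
    then show False by simp
  qed
  obtain d t where d: "d * d = scaleE t 1" "\<And>c. c * c \<noteq> t"
    "\<And>z. \<exists>a b. z = scaleE a 1 + scaleE b d"
    using Q.exists_root_generator[OF two] by metis
  define x where "x = \<iota> d"
  have x2: "x * x = scaleA t 1"
    unfolding x_def by (metis d(1) emb.map_mult emb.map_one emb.scale)
  interpret R: root_in_algebra scaleA t x
    using two d(2) x2 by unfold_locales auto
  define g' where "g' = unit_inv g"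
  have gg: "g * g' = 1" "g' * g = 1" using unit_inv[OF g] by (auto simp: g'_def)
  define y where "y = g * x * g'"
  have "y * y = g * (x * ((g' * g) * x)) * g'" by (simp add: y_def mult.assoc)
  then have "y * y = scaleA t 1"
    by (simp add: gg x2 A.mult_scale_left A.mult_scale_right)
  then obtain h h' where h: "h * h' = 1" "h' * h = 1" "h * x = y * h" "h * y = x * h"
    using R.exists_unit_swap by metis
  have yg: "y * g = g * x" by (simp add: y_def mult.assoc gg)
  have g'y: "g' * y = x * g'" by (simp add: y_def mult.assoc[symmetric] gg)
  \<comment> \<open>Commuting with \<open>x\<close> suffices because \<open>1\<close> and
    \<open>d\<close> span \<open>E\<close> over \<open>F\<close>.\<close>
  have inH: "z \<in> H" if z: "z \<in> unit_group" "z * x = x * z" for z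
  proof -
    have "z * \<iota> w = \<iota> w * z" for w
    proof -
      obtain a b where "w = scaleE a 1 + scaleE b d" using d(3) by blast
      then have "\<iota> w = scaleA a 1 + scaleA b x"
        by (simp add: x_def emb.add emb.scale emb.map_one)
      then show ?thesis
        by (simp add: distrib_left distrib_right A.mult_scale_left A.mult_scale_right z)
    qed
    then show ?thesis using assms z by (auto simp: centralizer_def)
  qed
  have hu: "h \<in> unit_group" "g' \<in> unit_group" using h gg by (auto simp: unit_group_def)
  \<comment> \<open>\<open>g' h x = g' y h = x g' h\<close>; likewise
    \<open>h g x = h y g = x h g\<close> for \<open>k2\<close>.\<close>
  have k1: "g' * h \<in> H"
    using unit_group_mult(1)[OF hu(2,1)] h(3) g'y by (intro inH) (auto, metis mult.assoc)
  have k2: "h * g \<in> H"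
    using unit_group_mult(1)[OF hu(1) g] h(4) yg by (intro inH) (auto, metis mult.assoc)
  have "g' * h * g * unit_inv (h * g) = g' * ((h * g) * unit_inv (h * g))"
    by (simp only: mult.assoc)
  then have "unit_inv g = g' * h * g * unit_inv (h * g)"
    using unit_inv(1)[OF unit_group_mult(1)[OF hu(1) g]] by (simp add: g'_def)
  then have inv: "unit_inv g \<in> double_coset H g"
    using k1 unit_inv_centralizer k2 assms unfolding double_coset_def by blast
  have H: "H = centralizer unit_group (\<iota> ` (UNIV - {0}))" using assms by simp
  have sub: "unit_inv ` double_coset H g \<subseteq> double_coset H g"
    by (rule double_coset_inv_subset[OF H g inv])
  moreover have "double_coset H g \<subseteq> unit_inv ` double_coset H g"
  proof
    fix z assume z: "z \<in> double_coset H g"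
    then have "z \<in> unit_group"
      using g unfolding double_coset_def H centralizer_def by (auto intro: unit_group_mult)
    then have "unit_inv (unit_inv z) = z" using unit_inv unit_inv_eqI by metis
    then show "z \<in> unit_inv ` double_coset H g"
      using sub z by (metis image_eqI image_subset_iff)
  qed
  ultimately show "unit_inv ` double_coset H g = double_coset H g" by blast
qed

end
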